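(* Let $G$ be an Eulerian multigraph (finite, without loops) such that $|E(G)|$ is odd. Then $G$ is not interval colorable, i.e., there is no positive integer $t$ for which $G$ has an interval $t$-coloring.
   Context: A multigraph may have multiple edges but no loops; all multigraphs are finite. A multigraph $G$ is Eulerian if it has a closed trail containing every edge of $G$. A proper edge-coloring of $G$ assigns colors to edges so that no two adjacent edges receive the same color. For a proper edge-coloring $\alpha$ and $v\in V(G)$, $S(v,\alpha)$ denotes the set of colors of edges incident to $v$. A proper edge-coloring of $G$ with colors $1,\ldots,t$ is an interval $t$-coloring if all colors $1,\ldots,t$ are used and for every vertex $v$ the set $S(v,\alpha)$ is an interval of consecutive integers. $G$ is interval colorable if it has an interval $t$-coloring for some positive integer $t$. *)

theory Defs
  imports Main
begin

record ('v, 'e) multigraph =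
  verts :: "'v set"
  edges :: "'e set"
  ends :: "'e \<Rightarrow> 'v set"

(* Requiring exactly two ends per edge excludes loops; ends need not be injective,
   so parallel edges are allowed. *)
definition finite_multigraph :: "('v, 'e) multigraph \<Rightarrow> bool" where
  "finite_multigraph G \<longleftrightarrow> finite (verts G) \<and> finite (edges G) \<and>
     (\<forall>e \<in> edges G. ends G e \<subseteq> verts G \<and> card (ends G e) = 2)"

fun walk :: "('v, 'e) multigraph \<Rightarrow> 'v \<Rightarrow> 'e list \<Rightarrow> 'v \<Rightarrow> bool" where
  "walk G u [] v \<longleftrightarrow> u \<in> verts G \<and> u = v"
| "walk G u (e # es) v \<longleftrightarrow>
     e \<in> edges G \<and> (\<exists>w \<in> verts G. ends G e = {u, w} \<and> walk G w es v)"

definition closed_trail :: "('v, 'e) multigraph \<Rightarrow> 'v \<Rightarrow> 'e list \<Rightarrow> bool" where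
  "closed_trail G u es \<longleftrightarrow> walk G u es u \<and> distinct es"

(* Isolated vertices are allowed: only the edges have to be covered. *)
definition Eulerian :: "('v, 'e) multigraph \<Rightarrow> bool" where
  "Eulerian G \<longleftrightarrow> (\<exists>u es. closed_trail G u es \<and> edges G \<subseteq> set es)"

definition proper_edge_coloring :: "('v, 'e) multigraph \<Rightarrow> ('e \<Rightarrow> nat) \<Rightarrow> bool" where
  "proper_edge_coloring G \<alpha> \<longleftrightarrow>
     (\<forall>e \<in> edges G. \<forall>f \<in> edges G. e \<noteq> f \<and> ends G e \<inter> ends G f \<noteq> {} \<longrightarrow> \<alpha> e \<noteq> \<alpha> f)"

definition spectrum :: "('v, 'e) multigraph \<Rightarrow> 'v \<Rightarrow> ('e \<Rightarrow> nat) \<Rightarrow> nat set" where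
  "spectrum G v \<alpha> = \<alpha> ` {e \<in> edges G. v \<in> ends G e}"

(* The interval at a vertex may be empty (a > b), so that isolated vertices impose
   no condition. *)
definition interval_coloring :: "('v, 'e) multigraph \<Rightarrow> nat \<Rightarrow> ('e \<Rightarrow> nat) \<Rightarrow> bool" where
  "interval_coloring G t \<alpha> \<longleftrightarrow>
     proper_edge_coloring G \<alpha> \<and> \<alpha> ` edges G = {1..t} \<and>
     (\<forall>v \<in> verts G. \<exists>a b. spectrum G v \<alpha> = {a..b})"

definition interval_colorable :: "('v, 'e) multigraph \<Rightarrow> bool" where
  "interval_colorable G \<longleftrightarrow> (\<exists>t > 0. \<exists>\<alpha>. interval_coloring G t \<alpha>)"

end

theory Submission imports Defs begin

text \<open>
  Weight each edge by \<open>-1\<close> to the power of its color. In an Eulerian multigraph all degrees are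
  even, so the colors at a vertex form an interval with an even number of elements and the weights
  around that vertex cancel. Summing over all vertices counts every edge twice, so the total weight
  of the edges is zero; but it is a sum of \<open>card (edges G)\<close> odd numbers.
\<close>

lemma walk_subset_edges: "walk G u es v \<Longrightarrow> set es \<subseteq> edges G"
  by (induction es arbitrary: u) auto

text \<open>Prepending an edge with ends \<open>u\<close> and \<open>w\<close> flips the parity
  exactly when \<open>x\<close> is one of the two, just as moving the start from \<open>w\<close> to
  \<open>u\<close> does. Open walks are allowed for the sake of the induction; closed ones have
  \<open>u = v\<close>.\<close>

lemma even_length_filter_incident_walk:
  assumes "walk G u es v" and "\<forall>e \<in> edges G. card (ends G e) = 2"
  shows "even (length (filter (\<lambda>e. x \<in> ends G e) es)) \<longleftrightarrow> (x = u \<longleftrightarrow> x = v)"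
  using assms(1)
proof (induction es arbitrary: u)
  case Nil
  then show ?case by simp
next
  case (Cons e es)
  then obtain w where w: "e \<in> edges G" "ends G e = {u, w}" "walk G w es v"
    by auto
  \<comment> \<open>No loops: at a loop the start would stay put while the count grows by
    one.\<close>
  have "card {u, w} = 2"
    using w(1,2) assms(2) by metis
  then have "u \<noteq> w"
    by auto
  then show ?case
    using Cons.IH[OF w(3)] w(2) by auto
qed

text \<open>The closed trail lists each edge exactly once, so the degree of \<open>x\<close> is a
  count along the list.\<close>

lemma Eulerian_even_degree:
  assumes "finite_multigraph G" and "Eulerian G"
  shows "even (card {e \<in> edges G. x \<in> ends G e})"
proof -
  obtain u es where es: "walk G u es u" "distinct es" "edges G \<subseteq> set es"
    using assms(2) by (auto simp: Eulerian_def closed_trail_def)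
  have "set es = edges G"
    using es(3) walk_subset_edges[OF es(1)] by blast
  then have "card {e \<in> edges G. x \<in> ends G e} = length (filter (\<lambda>e. x \<in> ends G e) es)"
    using distinct_card[of "filter (\<lambda>e. x \<in> ends G e) es"] es(2) by simp
  then show ?thesis
    using even_length_filter_incident_walk[OF es(1)] assms(1)
    by (simp add: finite_multigraph_def)
qed

lemma sum_minus_one_power_even_interval:
  fixes a b :: nat
  assumes "even (card {a..b})"
  shows "(\<Sum>i = a..b. (-1) ^ i) = (0 :: int)"
proof -
  \<comment> \<open>In half-open form, each induction step appends two consecutive terms, which
    cancel.\<close>
  have *: "(\<Sum>i = a..<a + 2 * k. (-1) ^ i) = (0 :: int)" for k
    by (induction k) simp_all
  \<comment> \<open>If \<open>a > b\<close>, truncated subtraction gives \<open>k = 0\<close>, so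
    the empty interval is covered.\<close>
  obtain k where k: "Suc b - a = 2 * k"
    using assms unfolding card_atLeastAtMost by (rule evenE)
  have "{a..b} = {a..<a + 2 * k}"
    unfolding k[symmetric] by auto
  then show ?thesis
    using * by simp
qed

lemma even_sum_minus_one_power:
  "finite A \<Longrightarrow> even (\<Sum>e\<in>A. (-1) ^ f e :: int) \<longleftrightarrow> even (card A)"
  by (induction A rule: finite_induct) auto

theorem theorem2:
  fixes G :: "('v, 'e) multigraph"
  assumes "finite_multigraph G"
    and "Eulerian G"
    and "odd (card (edges G))"
  shows "\<not> interval_colorable G"
proof
  assume "interval_colorable G"
  then obtain \<alpha> where proper: "proper_edge_coloring G \<alpha>"
    and interval: "\<And>v. v \<in> verts G \<Longrightarrow> \<exists>a b. spectrum G v \<alpha> = {a..b}"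
    by (auto simp: interval_colorable_def interval_coloring_def)
  have fin: "finite (verts G)" "finite (edges G)"
    and ends: "\<And>e. e \<in> edges G \<Longrightarrow> ends G e \<subseteq> verts G \<and> card (ends G e) = 2"
    using assms(1) by (auto simp: finite_multigraph_def)
  define w where "w e = ((-1) ^ \<alpha> e :: int)" for e
  have vertex: "(\<Sum>e \<in> {e \<in> edges G. v \<in> ends G e}. w e) = 0" if v: "v \<in> verts G" for v
  proof -
    let ?I = "{e \<in> edges G. v \<in> ends G e}"
    \<comment> \<open>Distinct edges at \<open>v\<close> are adjacent, so the interval of colors has
      as many elements as the degree of \<open>v\<close>.\<close>
    have inj: "inj_on \<alpha> ?I"
      using proper by (fastforce simp: inj_on_def proper_edge_coloring_def)
    obtain a b where ab: "\<alpha> ` ?I = {a..b}"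
      using interval[OF v] by (auto simp: spectrum_def)
    have "even (card {a..b})"
      using Eulerian_even_degree[OF assms(1,2)] card_image[OF inj] ab by metis
    moreover have "(\<Sum>e\<in>?I. w e) = (\<Sum>i = a..b. (-1) ^ i)"
      unfolding ab[symmetric] by (simp add: sum.reindex[OF inj] w_def)
    ultimately show ?thesis
      by (simp only: sum_minus_one_power_even_interval)
  qed
  have "2 * (\<Sum>e\<in>edges G. w e) = (\<Sum>e\<in>edges G. \<Sum>v \<in> ends G e. w e)"
    using ends by (simp add: sum_distrib_left)
  \<comment> \<open>Writing \<open>ends G e\<close> as a restriction of \<open>verts G\<close>
    prepares the exchange of the two sums.\<close>
  also have "\<dots> = (\<Sum>e\<in>edges G. \<Sum>v \<in> {v \<in> verts G. v \<in> ends G e}. w e)"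
    using ends by (intro sum.cong refl) auto
  also have "\<dots> = (\<Sum>v\<in>verts G. \<Sum>e \<in> {e \<in> edges G. v \<in> ends G e}. w e)"
    using fin by (intro sum.swap_restrict)
  also have "\<dots> = 0"
    using vertex by simp
  finally have "even (\<Sum>e\<in>edges G. w e)"
    by simp
  then show False
    using even_sum_minus_one_power[OF fin(2), of \<alpha>] assms(3) by (simp add: w_def)
qed

end
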